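(* Let $A$ be an arithmetical set and $n \geq 1$. There exist $m \in \omega$ and a coloring $f : [\omega]^n \to m$ such that every infinite set $H$ with $|f[H]^n| < d_n$ computes $A$.
   Context: $[\omega]^n$ denotes the set of $n$-element subsets of $\omega$. The Catalan numbers are defined by $d_0 = 1$ and $d_{j+1} = \sum_{i=0}^j d_i d_{j-i}$. *)

theory Defs
  imports "HOL-Library.Ramsey" "HOL-Library.FuncSet"
begin

fun catalan :: "nat \<Rightarrow> nat" where
  "catalan 0 = 1"
| "catalan (Suc j) = (\<Sum>i\<le>j. catalan i * catalan (j - i))"

text \<open>
  Indices of partial recursive functions with an oracle, and their evaluation relation:
  \<open>evalo X c xs y\<close> says that the function with index \<open>c\<close> and oracle \<open>X\<close> is defined at the
  argument tuple \<open>xs\<close> with value \<open>y\<close>. Indices carry no arity: one index may be defined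
  on tuples of different lengths.
\<close>

datatype rcode =
    RZero
  | RSucc
  | RProj nat
  | ROracle
  | RComp rcode "rcode list"
  | RPrim rcode rcode
  | RMin rcode

inductive evalo :: "nat set \<Rightarrow> rcode \<Rightarrow> nat list \<Rightarrow> nat \<Rightarrow> bool" for X :: "nat set" where
  zero: "evalo X RZero xs 0"
| succ: "evalo X RSucc [x] (Suc x)"
| proj: "i < length xs \<Longrightarrow> evalo X (RProj i) xs (xs ! i)"
| orac: "evalo X ROracle [x] (if x \<in> X then 1 else 0)"
| comp: "list_all2 (\<lambda>g y. evalo X g xs y) gs ys \<Longrightarrow> evalo X f ys z \<Longrightarrow> evalo X (RComp f gs) xs z"
| prim_0: "evalo X f xs y \<Longrightarrow> evalo X (RPrim f g) (0 # xs) y"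
| prim_Suc: "evalo X (RPrim f g) (k # xs) y \<Longrightarrow> evalo X g (k # y # xs) z
    \<Longrightarrow> evalo X (RPrim f g) (Suc k # xs) z"
| min: "evalo X f (k # xs) 0 \<Longrightarrow> (\<And>j. j < k \<Longrightarrow> \<exists>y. evalo X f (j # xs) (Suc y))
    \<Longrightarrow> evalo X (RMin f) xs k"

inductive_cases evalo_zeroE: "evalo X RZero xs z"
inductive_cases evalo_succE: "evalo X RSucc xs z"
inductive_cases evalo_projE: "evalo X (RProj i) xs z"
inductive_cases evalo_oracE: "evalo X ROracle xs z"
inductive_cases evalo_compE: "evalo X (RComp f gs) xs z"
inductive_cases evalo_prim_0E: "evalo X (RPrim f g) (0 # xs) z"
inductive_cases evalo_prim_SucE: "evalo X (RPrim f g) (Suc k # xs) z"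
inductive_cases evalo_minE: "evalo X (RMin f) xs z"

lemma evalo_deterministic: "evalo X c xs y \<Longrightarrow> evalo X c xs z \<Longrightarrow> y = z"
proof (induction arbitrary: z rule: evalo.induct)
  case (zero xs)
  then show ?case by (rule evalo_zeroE) simp
next
  case (succ x)
  then show ?case by (rule evalo_succE) simp
next
  case (proj i xs)
  from proj.prems show ?case by (rule evalo_projE) simp
next
  case (orac x)
  then show ?case by (rule evalo_oracE) simp_all
next
  case (comp xs gs ys f w)
  from comp.prems obtain ys' where gs: "list_all2 (\<lambda>g. evalo X g xs) gs ys'" and f: "evalo X f ys' z"
    by (rule evalo_compE)
  have "ys' = ys"
  proof (rule nth_equalityI)
    show "length ys' = length ys"
      using list_all2_lengthD[OF comp.IH(1)] list_all2_lengthD[OF gs] by simp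
  next
    fix i assume "i < length ys'"
    then have i: "i < length gs"
      using list_all2_lengthD[OF gs] by simp
    have "\<forall>w. evalo X (gs ! i) xs w \<longrightarrow> ys ! i = w"
      using list_all2_nthD[OF comp.IH(1) i] by (rule conjunct2)
    then have "evalo X (gs ! i) xs (ys' ! i) \<longrightarrow> ys ! i = ys' ! i" ..
    then have "ys ! i = ys' ! i" using list_all2_nthD[OF gs i] by (rule mp)
    then show "ys' ! i = ys ! i" ..
  qed
  then have "evalo X f ys z" using f by simp
  then show ?case by (rule comp.IH(2))
next
  case (prim_0 f xs y g)
  from prim_0.prems show ?case by (rule evalo_prim_0E) (rule prim_0.IH)
next
  case (prim_Suc f g k xs y w)
  from prim_Suc.prems obtain y' where y': "evalo X (RPrim f g) (k # xs) y'"
    and z: "evalo X g (k # y' # xs) z"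
    by (rule evalo_prim_SucE)
  from y' have "y = y'" by (rule prim_Suc.IH(1))
  with z have "evalo X g (k # y # xs) z" by simp
  then show ?case by (rule prim_Suc.IH(2))
next
  case (min f k xs)
  have z0: "evalo X f (z # xs) 0"
    using min.prems by (rule evalo_minE)
  have zS: "\<exists>y. evalo X f (j # xs) (Suc y)" if "j < z" for j
    using min.prems by (rule evalo_minE) (use that in iprover)
  have "\<not> z < k"
  proof
    assume "z < k"
    then obtain y where "\<And>w. evalo X f (z # xs) w \<Longrightarrow> Suc y = w"
      using min.IH(2) by meson
    from this[OF z0] show False by simp
  qed
  moreover have "\<not> k < z"
  proof
    assume "k < z"
    then obtain y where "evalo X f (k # xs) (Suc y)" using zS by iprover
    then have "0 = Suc y" by (rule min.IH(1))
    then show False by simp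
  qed
  ultimately show ?case by simp
qed

text \<open>Turing reducibility: some index with oracle \<open>X\<close> computes the characteristic function
  of \<open>A\<close>, and in particular converges on every input.\<close>

definition computes :: "nat set \<Rightarrow> nat set \<Rightarrow> bool" where
  "computes X A \<longleftrightarrow> (\<exists>c. \<forall>x. evalo X c [x] (if x \<in> A then 1 else 0))"

text \<open>First-order formulas in the language of arithmetic, with de Bruijn indices, interpreted in
  the standard model.\<close>

datatype aterm =
    AVar nat
  | AZero
  | ASucc aterm
  | AAdd aterm aterm
  | AMul aterm aterm

datatype aform =
    FEq aterm aterm
  | FLess aterm aterm
  | FNeg aform
  | FConj aform aform
  | FEx aform

primrec aval :: "(nat \<Rightarrow> nat) \<Rightarrow> aterm \<Rightarrow> nat" where
  "aval e (AVar i) = e i"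
| "aval e AZero = 0"
| "aval e (ASucc t) = Suc (aval e t)"
| "aval e (AAdd s t) = aval e s + aval e t"
| "aval e (AMul s t) = aval e s * aval e t"

primrec sat :: "(nat \<Rightarrow> nat) \<Rightarrow> aform \<Rightarrow> bool" where
  "sat e (FEq s t) \<longleftrightarrow> aval e s = aval e t"
| "sat e (FLess s t) \<longleftrightarrow> aval e s < aval e t"
| "sat e (FNeg p) \<longleftrightarrow> \<not> sat e p"
| "sat e (FConj p q) \<longleftrightarrow> sat e p \<and> sat e q"
| "sat e (FEx p) \<longleftrightarrow> (\<exists>x. sat (case_nat x e) p)"

text \<open>The variable with index 0 is the argument; the quantification over all \<open>e\<close> makes the
  values of the other variables irrelevant, so they cannot act as parameters.\<close>

definition arithmetical :: "nat set \<Rightarrow> bool" where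
  "arithmetical A \<longleftrightarrow> (\<exists>p. \<forall>e. sat e p \<longleftrightarrow> e 0 \<in> A)"

end

theory Submission imports Defs "HOL-Library.Nat_Bijection" begin

text \<open>
  By induction on the arithmetical definition, with colorings for subformulas joined into
  their product, it is enough to decide \<open>\<exists>x. P (x # zs)\<close> from an \<open>H\<close> that decides \<open>P\<close>. Say that
  \<open>c\<close> sees a jump of \<open>a\<close> after \<open>b\<close> if some \<open>zs\<close> bounded by \<open>a\<close> has its least witness in \<open>(b, c]\<close>,
  and that the step from \<open>a\<close> to \<open>b\<close> is small if some \<open>c\<close> sees such a jump. An increasing tuple is
  colored by its set of small steps \<open>i\<close> (from \<open>x\<^sub>i\<close> to \<open>x\<^sub>i\<^sub>+\<^sub>1\<close>) and by its pattern, the set of pairs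
  \<open>(i, k)\<close> such that \<open>x\<^sub>k\<close> sees that step \<open>i\<close> is small. Patterns are decidable from \<open>H\<close>. So if \<open>H\<close> does not decide
  \<open>\<exists>x. P (x # zs)\<close>, each pattern that occurs arbitrarily far out in \<open>H\<close> also occurs there with
  its first and last entries a small distance apart, which makes all its steps small. Such a tuple can be
  followed by any other tuple of \<open>H\<close> placed far enough above it: the junction is large and is
  the first step that the final entry does not see to be small. Hence the numbers of patterns of
  size \<open>m + 1\<close> and of colors of size \<open>m\<close> both dominate the Catalan recursion.
\<close>

section \<open>Functions and relations computable from an oracle\<close>

text \<open>Fixing the length \<open>k\<close> makes up for indices without arity: a code must
  converge on every tuple of this length and is unconstrained on the others.\<close>

definition computable_in :: "nat set \<Rightarrow> nat \<Rightarrow> (nat list \<Rightarrow> nat) \<Rightarrow> bool" where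
  "computable_in X k F \<longleftrightarrow> (\<exists>c. \<forall>xs. length xs = k \<longrightarrow> evalo X c xs (F xs))"

definition decidable_in :: "nat set \<Rightarrow> nat \<Rightarrow> (nat list \<Rightarrow> bool) \<Rightarrow> bool" where
  "decidable_in X k P \<longleftrightarrow> computable_in X k (\<lambda>xs. of_bool (P xs))"

lemma computable_in_cong:
  "computable_in X k F \<Longrightarrow> (\<And>xs. length xs = k \<Longrightarrow> F xs = G xs) \<Longrightarrow> computable_in X k G"
  by (auto simp: computable_in_def)

lemma decidable_in_cong:
  "decidable_in X k P \<Longrightarrow> (\<And>xs. length xs = k \<Longrightarrow> P xs = Q xs) \<Longrightarrow> decidable_in X k Q"
  unfolding decidable_in_def by (erule computable_in_cong) simp

lemma computable_in_nth: "i < k \<Longrightarrow> computable_in X k (\<lambda>xs. xs ! i)"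
  unfolding computable_in_def by (metis evalo.proj)

lemma computable_in_comp:
  assumes F: "computable_in X j F" and G: "\<And>G. G \<in> set Gs \<Longrightarrow> computable_in X k G"
    and j: "length Gs = j"
  shows "computable_in X k (\<lambda>xs. F (map (\<lambda>G. G xs) Gs))"
proof -
  obtain c where c: "\<And>xs. length xs = j \<Longrightarrow> evalo X c xs (F xs)"
    using F unfolding computable_in_def by blast
  obtain d where d: "\<And>G xs. G \<in> set Gs \<Longrightarrow> length xs = k \<Longrightarrow> evalo X (d G) xs (G xs)"
    using G unfolding computable_in_def by metis
  have "evalo X (RComp c (map d Gs)) xs (F (map (\<lambda>G. G xs) Gs))" if "length xs = k" for xs
  proof (rule evalo.comp)
    show "list_all2 (\<lambda>g. evalo X g xs) (map d Gs) (map (\<lambda>G. G xs) Gs)"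
      using d that by (simp add: list_all2_conv_all_nth)
    show "evalo X c (map (\<lambda>G. G xs) Gs) (F (map (\<lambda>G. G xs) Gs))"
      using c j by simp
  qed
  then show ?thesis unfolding computable_in_def by blast
qed

lemma computable_in_comp1:
  assumes "computable_in X 1 (\<lambda>xs. f (xs ! 0))" and "computable_in X k F"
  shows "computable_in X k (\<lambda>xs. f (F xs))"
  using computable_in_comp[OF assms(1), of "[F]" k] assms(2) by simp

lemma computable_in_comp2:
  assumes "computable_in X 2 (\<lambda>xs. f (xs ! 0) (xs ! 1))"
    and "computable_in X k F" and "computable_in X k G"
  shows "computable_in X k (\<lambda>xs. f (F xs) (G xs))"
  using computable_in_comp[OF assms(1), of "[F, G]" k] assms(2,3) by auto

section \<open>Arithmetic functions\<close>

lemma computable_in_Suc: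
  assumes "computable_in X k F"
  shows "computable_in X k (\<lambda>xs. Suc (F xs))"
proof (rule computable_in_comp1[OF _ assms])
  show "computable_in X 1 (\<lambda>xs. Suc (xs ! 0))"
    unfolding computable_in_def
    by (rule exI[of _ RSucc]) (auto simp: length_Suc_conv intro: evalo.succ)
qed

lemma computable_in_const: "computable_in X k (\<lambda>_. n)"
proof (induction n)
  case 0
  show ?case unfolding computable_in_def using evalo.zero by blast
next
  case (Suc n)
  then show ?case by (rule computable_in_Suc)
qed

text \<open>One recursion parameter is enough, since \<open>F\<close> and \<open>G\<close> enter by
  composition. \<open>RPrim\<close> passes the counter, the previous value and the parameter in this
  order, hence the permuted arguments of \<open>g\<close>.\<close>

lemma computable_in_rec_nat:
  assumes f: "computable_in X 1 (\<lambda>xs. f (xs ! 0))"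
    and g: "computable_in X 3 (\<lambda>xs. g (xs ! 2) (xs ! 0) (xs ! 1))"
    and F: "computable_in X k F" and G: "computable_in X k G"
  shows "computable_in X k (\<lambda>xs. rec_nat (f (G xs)) (g (G xs)) (F xs))"
proof (rule computable_in_comp2[OF _ F G])
  obtain c where c: "\<And>y. evalo X c [y] (f y)"
    using f unfolding computable_in_def by (force simp: length_Suc_conv)
  obtain d where d: "\<And>xs. length xs = 3 \<Longrightarrow> evalo X d xs (g (xs ! 2) (xs ! 0) (xs ! 1))"
    using g unfolding computable_in_def by blast
  have d': "evalo X d [n, z, y] (g y n z)" for n z y
    using d[of "[n, z, y]"] by simp
  have "evalo X (RPrim c d) [n, y] (rec_nat (f y) (g y) n)" for n y
    by (induction n) (auto intro: evalo.prim_0 evalo.prim_Suc c d')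
  then show "computable_in X 2 (\<lambda>xs. rec_nat (f (xs ! 1)) (g (xs ! 1)) (xs ! 0))"
    unfolding computable_in_def
    by (intro exI[of _ "RPrim c d"]) (auto simp: length_Suc_conv numeral_2_eq_2)
qed

lemma computable_in_add:
  assumes "computable_in X k F" and "computable_in X k G"
  shows "computable_in X k (\<lambda>xs. F xs + G xs)"
proof -
  have "rec_nat y (\<lambda>_. Suc) n = n + y" for n y :: nat
    by (induction n) auto
  then show ?thesis
    using computable_in_rec_nat[of X "\<lambda>y. y" "\<lambda>_ _. Suc", OF _ _ assms]
    by (simp add: computable_in_nth computable_in_Suc)
qed

lemma computable_in_mult:
  assumes "computable_in X k F" and "computable_in X k G"
  shows "computable_in X k (\<lambda>xs. F xs * G xs)"
proof -
  have "rec_nat 0 (\<lambda>_ z. z + y) n = n * y" for n y :: nat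
    by (induction n) auto
  then show ?thesis
    using computable_in_rec_nat[of X "\<lambda>y. 0" "\<lambda>y _ z. z + y", OF _ _ assms]
    by (simp add: computable_in_nth computable_in_const computable_in_add)
qed

lemma computable_in_diff:
  assumes "computable_in X k F" and "computable_in X k G"
  shows "computable_in X k (\<lambda>xs. F xs - G xs)"
proof -
  have "rec_nat 0 (\<lambda>m _. m) n = n - 1" for n :: nat
    by (cases n) auto
  then have pred: "computable_in X k (\<lambda>xs. F xs - 1)" if "computable_in X k F" for k F
    using computable_in_rec_nat[of X "\<lambda>y. 0" "\<lambda>_ m _. m", OF _ _ that that]
    by (simp add: computable_in_nth computable_in_const)
  have "rec_nat y (\<lambda>_ z. z - 1) n = y - n" for n y :: nat
    by (induction n) auto
  then show ?thesis
    using computable_in_rec_nat[of X "\<lambda>y. y" "\<lambda>_ _ z. z - 1", OF _ _ assms(2,1)] pred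
    by (simp add: computable_in_nth)
qed

section \<open>Boolean combinations, comparisons and oracle queries\<close>

lemma decidable_in_const: "decidable_in X k (\<lambda>_. b)"
  unfolding decidable_in_def by (rule computable_in_const)

lemma decidable_in_not:
  assumes "decidable_in X k P"
  shows "decidable_in X k (\<lambda>xs. \<not> P xs)"
  using computable_in_diff[OF computable_in_const[of X k 1] assms[unfolded decidable_in_def]]
  unfolding decidable_in_def by (rule computable_in_cong) simp

lemma decidable_in_conj:
  assumes "decidable_in X k P" and "decidable_in X k Q"
  shows "decidable_in X k (\<lambda>xs. P xs \<and> Q xs)"
  using computable_in_mult[OF assms[unfolded decidable_in_def]]
  unfolding decidable_in_def by (rule computable_in_cong) simp

lemma decidable_in_disj:
  assumes "decidable_in X k P" and "decidable_in X k Q"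
  shows "decidable_in X k (\<lambda>xs. P xs \<or> Q xs)"
  using decidable_in_not[OF decidable_in_conj[OF assms[THEN decidable_in_not]]] by simp

lemma decidable_in_iff_const:
  assumes "decidable_in X k P"
  shows "decidable_in X k (\<lambda>xs. P xs \<longleftrightarrow> b)"
  using assms decidable_in_not[OF assms] by (cases b) simp_all

lemma decidable_in_ball_finite:
  assumes "finite I" and "\<And>i. i \<in> I \<Longrightarrow> decidable_in X k (P i)"
  shows "decidable_in X k (\<lambda>xs. \<forall>i\<in>I. P i xs)"
  using assms by (induction I) (auto intro: decidable_in_const decidable_in_conj)

lemma decidable_in_less:
  assumes "computable_in X k F" and "computable_in X k G"
  shows "decidable_in X k (\<lambda>xs. F xs < G xs)"
proof -
  have "computable_in X k (\<lambda>xs. 1 - (1 - (G xs - F xs)))"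
    by (intro computable_in_diff computable_in_const assms)
  then show ?thesis
    unfolding decidable_in_def by (rule computable_in_cong) auto
qed

lemma decidable_in_le:
  assumes "computable_in X k F" and "computable_in X k G"
  shows "decidable_in X k (\<lambda>xs. F xs \<le> G xs)"
  using decidable_in_not[OF decidable_in_less[OF assms(2,1)]] by (simp add: not_less)

lemma decidable_in_eq:
  assumes "computable_in X k F" and "computable_in X k G"
  shows "decidable_in X k (\<lambda>xs. F xs = G xs)"
  using decidable_in_conj[OF decidable_in_le[OF assms] decidable_in_le[OF assms(2,1)]]
  by (simp add: eq_iff)

lemma decidable_in_oracle:
  assumes "computable_in X k F"
  shows "decidable_in X k (\<lambda>xs. F xs \<in> X)"
  unfolding decidable_in_def
proof (rule computable_in_comp1[OF _ assms, of "\<lambda>x. of_bool (x \<in> X)"])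
  have "evalo X ROracle xs (of_bool (xs ! 0 \<in> X))" if "length xs = 1" for xs
    using evalo.orac[of X "xs ! 0"] that by (auto simp: length_Suc_conv of_bool_def)
  then show "computable_in X 1 (\<lambda>xs. of_bool (xs ! 0 \<in> X))"
    unfolding computable_in_def by blast
qed

lemma decidable_in_comp:
  assumes "decidable_in X j P" and "\<And>G. G \<in> set Gs \<Longrightarrow> computable_in X k G"
    and "length Gs = j"
  shows "decidable_in X k (\<lambda>xs. P (map (\<lambda>G. G xs) Gs))"
  using computable_in_comp[OF assms(1)[unfolded decidable_in_def] assms(2,3)]
  unfolding decidable_in_def .

section \<open>Search and bounded quantifiers\<close>

lemma computable_in_Least:
  assumes P: "decidable_in X (Suc k) P" and ex: "\<And>xs. length xs = k \<Longrightarrow> \<exists>y. P (y # xs)"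
  shows "computable_in X k (\<lambda>xs. LEAST y. P (y # xs))"
proof -
  \<comment> \<open>\<open>RMin\<close> looks for the value 0, so it is given a code for the
    negation.\<close>
  obtain c where c: "\<And>xs. length xs = Suc k \<Longrightarrow> evalo X c xs (of_bool (\<not> P xs))"
    using decidable_in_not[OF P] unfolding decidable_in_def computable_in_def by blast
  have "evalo X (RMin c) xs (LEAST y. P (y # xs))" if xs: "length xs = k" for xs
  proof (rule evalo.min)
    have "P ((LEAST y. P (y # xs)) # xs)"
      using ex[OF xs] by (rule LeastI_ex)
    then show "evalo X c ((LEAST y. P (y # xs)) # xs) 0"
      using c[of "(LEAST y. P (y # xs)) # xs"] xs by simp
    fix j assume "j < (LEAST y. P (y # xs))"
    then have "\<not> P (j # xs)" by (rule not_less_Least)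
    then show "\<exists>y. evalo X c (j # xs) (Suc y)"
      using c[of "j # xs"] xs by auto
  qed
  then show ?thesis unfolding computable_in_def by blast
qed

lemma decidable_in_subst_hd:
  assumes "decidable_in X (Suc k) P" and "computable_in X k F"
  shows "decidable_in X k (\<lambda>xs. P (F xs # xs))"
proof -
  have "decidable_in X k (\<lambda>xs. P (map (\<lambda>G. G xs) (F # map (\<lambda>i xs. xs ! i) [0..<k])))"
    by (rule decidable_in_comp[OF assms(1)]) (use assms(2) in \<open>auto intro: computable_in_nth\<close>)
  then show ?thesis
    by (rule decidable_in_cong) (simp add: comp_def, metis map_nth)
qed

text \<open>Stopping the search at \<open>b xs\<close> makes it total. It returns a witness if there
  is one up to the bound and otherwise \<open>b xs\<close>, so a single test of \<open>P\<close> at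
  the result settles the question.\<close>

lemma decidable_in_bex:
  assumes P: "decidable_in X (Suc k) P" and b: "computable_in X k b"
  shows "decidable_in X k (\<lambda>xs. \<exists>y\<le>b xs. P (y # xs))"
proof -
  let ?y = "\<lambda>xs. LEAST y. b xs \<le> y \<or> P (y # xs)"
  \<comment> \<open>Position 0 now holds the candidate \<open>y\<close>, so the bound is evaluated
    on the tail.\<close>
  have tl: "computable_in X (Suc k) (\<lambda>xs. b (tl xs))"
  proof (rule computable_in_cong)
    show "computable_in X (Suc k) (\<lambda>xs. b (map (\<lambda>G. G xs) (map (\<lambda>i xs. xs ! Suc i) [0..<k])))"
      by (rule computable_in_comp[OF b]) (auto intro: computable_in_nth)
  qed (auto simp: length_Suc_conv comp_def map_nth)
  have "decidable_in X (Suc k) (\<lambda>xs. b (tl xs) \<le> xs ! 0 \<or> P xs)"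
    by (intro decidable_in_disj decidable_in_le tl computable_in_nth P) simp
  from computable_in_Least[OF this] have "computable_in X k ?y"
    by auto
  from decidable_in_subst_hd[OF P this] show ?thesis
  proof (rule decidable_in_cong)
    fix xs :: "nat list"
    have le: "?y xs \<le> b xs" by (rule Least_le) simp
    show "P (?y xs # xs) \<longleftrightarrow> (\<exists>y\<le>b xs. P (y # xs))"
    proof
      assume "\<exists>y\<le>b xs. P (y # xs)"
      then obtain y where y: "y \<le> b xs" "P (y # xs)" by blast
      have "?y xs \<le> y" using y(2) by (intro Least_le) simp
      moreover have "b xs \<le> ?y xs \<or> P (?y xs # xs)"
        by (rule LeastI[of "\<lambda>y. b xs \<le> y \<or> P (y # xs)" "b xs"]) simp
      ultimately show "P (?y xs # xs)" using y by (metis le_antisym le_trans)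
    qed (use le in blast)
  qed
qed

lemma decidable_in_bex_list:
  assumes "decidable_in X (r + k) P" and "j < k"
  shows "decidable_in X k (\<lambda>zs. \<exists>ys. length ys = r \<and> set ys \<subseteq> {..zs ! j} \<and> P (ys @ zs))"
  using assms
proof (induction r arbitrary: P)
  case (Suc r)
  \<comment> \<open>Behind the \<open>r\<close> remaining entries the bound \<open>zs ! j\<close>
    sits at index \<open>r + j\<close>.\<close>
  have "decidable_in X (r + k) (\<lambda>ws. \<exists>y\<le>ws ! (r + j). P (y # ws))"
    using Suc.prems by (intro decidable_in_bex computable_in_nth) auto
  from Suc.IH[OF this Suc.prems(2)] show ?case
  proof (rule decidable_in_cong)
    fix zs :: "nat list"
    have "(\<exists>y\<le>(ys @ zs) ! (r + j). P (y # ys @ zs)) \<longleftrightarrow> (\<exists>y\<le>zs ! j. P ((y # ys) @ zs))"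
      if "length ys = r" for ys
      using that by (simp add: nth_append)
    then have "(\<exists>ys. length ys = r \<and> set ys \<subseteq> {..zs ! j} \<and>
          (\<exists>y\<le>(ys @ zs) ! (r + j). P (y # ys @ zs))) \<longleftrightarrow>
        (\<exists>y ys. length ys = r \<and> set (y # ys) \<subseteq> {..zs ! j} \<and> P ((y # ys) @ zs))"
      by (simp only: set_simps insert_subset atMost_iff) blast
    also have "\<dots> \<longleftrightarrow> (\<exists>ys. length ys = Suc r \<and> set ys \<subseteq> {..zs ! j} \<and> P (ys @ zs))"
      (is "?L \<longleftrightarrow> ?R")
    proof
      assume ?R
      then obtain ys where ys: "length ys = Suc r" "set ys \<subseteq> {..zs ! j}" "P (ys @ zs)" by blast
      then obtain y ys' where "ys = y # ys'" by (auto simp: length_Suc_conv)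
      with ys show ?L by auto
    next
      assume ?L
      then obtain y ys where "length ys = r" "set (y # ys) \<subseteq> {..zs ! j}" "P ((y # ys) @ zs)" by blast
      then show ?R by (intro exI[of _ "y # ys"]) simp
    qed
    finally show "(\<exists>ys. length ys = r \<and> set ys \<subseteq> {..zs ! j} \<and>
          (\<exists>y\<le>(ys @ zs) ! (r + j). P (y # ys @ zs))) \<longleftrightarrow>
        (\<exists>ys. length ys = Suc r \<and> set ys \<subseteq> {..zs ! j} \<and> P (ys @ zs))" .
  qed
qed simp


section \<open>Patterns of increasing tuples\<close>

definition pairs :: "nat \<Rightarrow> (nat \<times> nat) set" where
  "pairs m = {(i, k). Suc i < k \<and> k < m}"

text \<open>The pattern of a tuple of length \<open>N\<close> cut after index \<open>l\<close>,
  provided that every entry after the cut sees all steps before it and that the junction step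
  \<open>l\<close> is large. \<open>P\<close> and \<open>Q\<close> are the patterns of the two
  parts.\<close>

definition glue :: "nat \<Rightarrow> nat \<Rightarrow> (nat \<times> nat) set \<Rightarrow> (nat \<times> nat) set \<Rightarrow> (nat \<times> nat) set" where
  "glue l N P Q = P \<union> {(i, k). i < l \<and> l < k \<and> k < N} \<union>
     {(i, k). l < i \<and> l < k \<and> (i - Suc l, k - Suc l) \<in> Q}"

lemma finite_pairs: "finite (pairs m)"
  by (rule finite_subset[of _ "{..<m} \<times> {..<m}"]) (auto simp: pairs_def)

text \<open>\<open>P\<close> consists of the pairs with \<open>k \<le> l\<close>, and the pairs from
  \<open>Q\<close> are those with both indices beyond \<open>l\<close>, so each part can be read
  off.\<close>

lemma glue_inject:
  assumes "glue l N P Q = glue l N P' Q'"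
    and "P \<subseteq> pairs (Suc l)" and "P' \<subseteq> pairs (Suc l)"
  shows "P = P' \<and> Q = Q'"
proof -
  have P: "{(i, k). (i, k) \<in> glue l N P Q \<and> k \<le> l} = P" if "P \<subseteq> pairs (Suc l)" for P Q
    using that by (auto simp: glue_def pairs_def)
  have Q: "{(i, k). (i + Suc l, k + Suc l) \<in> glue l N P Q} = Q" if "P \<subseteq> pairs (Suc l)" for P Q
    using that by (auto simp: glue_def pairs_def)
  show ?thesis
    using P[OF assms(2), of Q] P[OF assms(3), of Q'] Q[OF assms(2), of Q] Q[OF assms(3), of Q']
    unfolding assms(1) by simp
qed

text \<open>Column \<open>N - 1\<close> belongs to the second part, where every step before the cut
  is seen and the junction is not. \<open>Suc l < N\<close> says that this part is nonempty.\<close>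

lemma glue_index:
  assumes "P \<subseteq> pairs (Suc l)" and "Suc l < N"
  shows "(LEAST i. (i, N - 1) \<notin> glue l N P Q) = l"
  using assms by (intro Least_equality) (auto simp: glue_def pairs_def not_less[symmetric])

text \<open>
  \<open>jump a b c\<close> stands for: an approximation, restricted to arguments up to \<open>a\<close>, changes
  after stage \<open>b\<close> and no later than stage \<open>c\<close>.
\<close>

locale settling =
  fixes jump :: "nat \<Rightarrow> nat \<Rightarrow> nat \<Rightarrow> bool"
  assumes jump_mono: "jump a b c \<Longrightarrow> a \<le> a' \<Longrightarrow> b' \<le> b \<Longrightarrow> c \<le> c' \<Longrightarrow> jump a' b' c'"
    and settles: "\<exists>b. \<forall>c. \<not> jump a b c"
begin

section \<open>Patterns and colors of tuples, and their concatenation\<close>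

definition small :: "nat \<Rightarrow> nat \<Rightarrow> bool" where
  "small a b \<longleftrightarrow> (\<exists>c. jump a b c)"

definition pattern :: "nat list \<Rightarrow> (nat \<times> nat) set" where
  "pattern ys = {(i, k). Suc i < k \<and> k < length ys \<and> jump (ys ! i) (ys ! Suc i) (ys ! k)}"

text \<open>Smallness involves an unbounded quantifier over stages, so a search can test for a given
  pattern but not in general for this set. This is why compression concerns patterns only.\<close>

definition small_steps :: "nat list \<Rightarrow> nat set" where
  "small_steps ys = {i. Suc i < length ys \<and> small (ys ! i) (ys ! Suc i)}"

definition color :: "nat list \<Rightarrow> (nat \<times> nat) set \<times> nat set" where
  "color ys = (pattern ys, small_steps ys)"

text \<open>Occurrence beyond every bound lets a tuple be placed above a stage that depends on a
  tuple chosen before it.\<close>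

definition occurs :: "nat set \<Rightarrow> nat \<Rightarrow> (nat list \<Rightarrow> bool) \<Rightarrow> bool" where
  "occurs H m Q \<longleftrightarrow>
     (\<forall>a. \<exists>ys. length ys = m \<and> sorted_wrt (<) ys \<and> set ys \<subseteq> H \<inter> {a..} \<and> Q ys)"

lemma small_mono: "small a b \<Longrightarrow> a \<le> a' \<Longrightarrow> b' \<le> b \<Longrightarrow> small a' b'"
  unfolding small_def using jump_mono by blast

lemma pattern_subset: "pattern ys \<subseteq> pairs (length ys)"
  by (auto simp: pattern_def pairs_def)

lemma finite_color: "finite (color ` {ys. length ys = m})"
proof (rule finite_subset)
  show "color ` {ys. length ys = m} \<subseteq> Pow (pairs m) \<times> Pow {..<m}"
    using pattern_subset by (auto simp: color_def small_steps_def)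
qed (simp add: finite_pairs)

lemma occurs_mono: "occurs H m Q \<Longrightarrow> (\<And>ys. length ys = m \<Longrightarrow> Q ys \<Longrightarrow> R ys) \<Longrightarrow> occurs H m R"
  unfolding occurs_def by meson

text \<open>For \<open>k\<close> beyond the first part, the position of \<open>i\<close> relative to
  the cut decides: \<open>seen\<close> puts in all \<open>i < l\<close>, \<open>large\<close> keeps
  out \<open>i = l\<close>, and later pairs are shifted pairs of \<open>ys\<close>.\<close>

lemma pattern_append:
  assumes l: "length xs = Suc l"
    and seen: "\<And>i y. i < l \<Longrightarrow> y \<in> set ys \<Longrightarrow> jump (xs ! i) (xs ! Suc i) y"
    and large: "\<And>y. y \<in> set ys \<Longrightarrow> \<not> small (xs ! l) y"
  shows "pattern (xs @ ys) = glue l (Suc l + length ys) (pattern xs) (pattern ys)"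
proof -
  have "(i, k) \<in> pattern (xs @ ys) \<longleftrightarrow> (i, k) \<in> glue l (Suc l + length ys) (pattern xs) (pattern ys)"
    for i k
  proof -
    consider "k \<le> l" | "l < k" "k < Suc l + length ys" | "Suc l + length ys \<le> k" by linarith
    then show ?thesis
    proof cases
      case 2
      then have k: "k - Suc l < length ys" by simp
      \<comment> \<open>The junction step leads to \<open>ys ! 0\<close>, whichever entry observes
        it.\<close>
      then have y: "ys ! (k - Suc l) \<in> set ys" "ys ! 0 \<in> set ys" by (auto intro!: nth_mem)
      consider "i < l" | "i = l" | "l < i" by linarith
      then show ?thesis
      proof cases
        case 1
        then show ?thesis using 2 l seen[OF 1 y(1)]
          by (simp add: pattern_def glue_def nth_append)
      next
        case 2
        then show ?thesis using \<open>l < k\<close> l large[OF y(2)]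
          by (auto simp: pattern_def glue_def nth_append small_def)
      next
        case 3
        then show ?thesis using 2 l
          by (auto simp: pattern_def glue_def nth_append Suc_diff_Suc less_diff_conv2)
      qed
    qed (use l in \<open>auto simp: pattern_def glue_def nth_append\<close>)
  qed
  then show ?thesis by auto
qed

lemma small_steps_append:
  assumes l: "length xs = Suc l"
    and small: "\<And>i. i < l \<Longrightarrow> small (xs ! i) (xs ! Suc i)"
    and large: "\<And>y. y \<in> set ys \<Longrightarrow> \<not> small (xs ! l) y"
  shows "small_steps (xs @ ys) = {..<l} \<union> {i. l < i \<and> i - Suc l \<in> small_steps ys}"
proof -
  have "i \<in> small_steps (xs @ ys) \<longleftrightarrow> i < l \<or> l < i \<and> i - Suc l \<in> small_steps ys" for i
  proof -
    consider "i < l" | "i = l" | "l < i" by linarith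
    then show ?thesis
    proof cases
      case 1
      then show ?thesis using small l by (simp add: small_steps_def nth_append)
    next
      case 2
      \<comment> \<open>With \<open>ys\<close> empty there is no step \<open>l\<close> at
        all.\<close>
      then show ?thesis using large l by (cases ys) (auto simp: small_steps_def nth_append)
    next
      case 3
      then show ?thesis using l by (auto simp: small_steps_def nth_append Suc_diff_Suc)
    qed
  qed
  then show ?thesis by auto
qed

text \<open>The second part is put so far above the first that it sees all small steps of the first.\<close>

lemma occurs_append:
  assumes xs: "occurs H (Suc l) (\<lambda>xs. pattern xs = P \<and> small (hd xs) (last xs))"
    and ys: "occurs H r R"
  shows "occurs H (Suc l + r) (\<lambda>zs. \<exists>ys. length ys = r \<and> R ys \<and>
      pattern zs = glue l (Suc l + r) P (pattern ys) \<and>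
      small_steps zs = {..<l} \<union> {i. l < i \<and> i - Suc l \<in> small_steps ys})"
  unfolding occurs_def
proof
  fix a
  from xs obtain xs where x: "length xs = Suc l" "sorted_wrt (<) xs" "set xs \<subseteq> H \<inter> {a..}"
      "pattern xs = P" "small (hd xs) (last xs)"
    unfolding occurs_def by blast
  have hd: "hd xs = xs ! 0" and last: "last xs = xs ! l"
    using x(1) by (auto simp: hd_conv_nth last_conv_nth length_Suc_conv)
  \<comment> \<open>This stage witnesses that the whole span is small; by monotonicity it serves for
    each step in between.\<close>
  obtain c where c: "jump (xs ! 0) (xs ! l) c"
    using x(5) hd last by (auto simp: small_def)
  \<comment> \<open>Every step from \<open>xs ! l\<close> to an entry \<open>\<ge> b\<close> is
    large.\<close>
  obtain b where b: "\<And>c. \<not> jump (xs ! l) b c" using settles by blast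
  have mono: "xs ! i \<le> xs ! j" if "i \<le> j" "j \<le> l" for i j
    using sorted_wrt_nth_less[OF x(2), of i j] that x(1) by (cases "i = j") auto
  from ys obtain ys where y: "length ys = r" "sorted_wrt (<) ys"
      "set ys \<subseteq> H \<inter> {max a (max b (max c (Suc (xs ! l))))..}" "R ys"
    unfolding occurs_def by blast
  have ge: "a \<le> y" "b \<le> y" "c \<le> y" "xs ! l < y" if "y \<in> set ys" for y
    using y(3) that by (auto simp: subset_iff)
  have seen: "jump (xs ! i) (xs ! Suc i) y" if "i < l" "y \<in> set ys" for i y
  proof (rule jump_mono[OF c])
    show "xs ! 0 \<le> xs ! i" "xs ! Suc i \<le> xs ! l" using that by (simp_all add: mono)
    show "c \<le> y" using that(2) by (rule ge(3))
  qed
  have small: "small (xs ! i) (xs ! Suc i)" if "i < l" for i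
  proof (rule small_mono)
    show "small (xs ! 0) (xs ! l)" using c unfolding small_def by blast
    show "xs ! 0 \<le> xs ! i" "xs ! Suc i \<le> xs ! l" using that by (simp_all add: mono)
  qed
  have large: "\<not> small (xs ! l) y" if "y \<in> set ys" for y
    using small_mono[OF _ order_refl ge(2)[OF that]] b unfolding small_def by blast
  have "sorted_wrt (<) (xs @ ys)"
    unfolding sorted_wrt_append
  proof (intro conjI ballI)
    fix u v assume u: "u \<in> set xs" and v: "v \<in> set ys"
    from u obtain i where "i \<le> l" "u = xs ! i" using x(1) by (auto simp: in_set_conv_nth less_Suc_eq_le)
    then show "u < v" using mono[of i l] ge(4)[OF v] by simp
  qed (use x y in auto)
  moreover have "set (xs @ ys) \<subseteq> H \<inter> {a..}" using x(3) y(3) ge(1) by auto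
  ultimately show "\<exists>zs. length zs = Suc l + r \<and> sorted_wrt (<) zs \<and> set zs \<subseteq> H \<inter> {a..} \<and>
      (\<exists>ys. length ys = r \<and> R ys \<and> pattern zs = glue l (Suc l + r) P (pattern ys) \<and>
        small_steps zs = {..<l} \<union> {i. l < i \<and> i - Suc l \<in> small_steps ys})"
    using x(1,4) y(1,4) pattern_append[OF x(1) seen large] small_steps_append[OF x(1) small large]
    by (intro exI[of _ "xs @ ys"] conjI exI[of _ ys]) simp_all
qed

section \<open>Counting patterns and colors that occur beyond every bound\<close>

definition packed :: "nat set \<Rightarrow> nat \<Rightarrow> (nat \<times> nat) set set" where
  "packed H m = {P. occurs H m (\<lambda>ys. pattern ys = P)}"

definition colors :: "nat set \<Rightarrow> nat \<Rightarrow> ((nat \<times> nat) set \<times> nat set) set" where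
  "colors H m = {C. occurs H m (\<lambda>ys. color ys = C)}"

lemma packed_subset:
  assumes "P \<in> packed H m"
  shows "P \<subseteq> pairs m"
proof -
  from assms obtain ys where "length ys = m" "pattern ys = P"
    unfolding packed_def occurs_def by blast
  then show ?thesis using pattern_subset by blast
qed

lemma finite_packed: "finite (packed H m)"
  by (rule finite_subset[of _ "Pow (pairs m)"]) (auto simp: finite_pairs dest: packed_subset)

lemma colors_subset: "colors H m \<subseteq> color ` {ys. sorted_wrt (<) ys \<and> length ys = m \<and> set ys \<subseteq> H}"
proof
  fix C assume "C \<in> colors H m"
  then obtain ys where "length ys = m" "sorted_wrt (<) ys" "set ys \<subseteq> H \<inter> {0..}" "color ys = C"
    unfolding colors_def occurs_def by blast
  then show "C \<in> color ` {ys. sorted_wrt (<) ys \<and> length ys = m \<and> set ys \<subseteq> H}" by blast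
qed

lemma finite_colors: "finite (colors H m)"
  by (rule finite_subset[OF _ finite_color[of m]]) (use colors_subset in blast)

end

text \<open>The only trace of undecidability that the counting uses: each member of
  \<open>packed H (Suc m)\<close> can serve as the first part in \<open>occurs_append\<close>. The
  length is positive so that \<open>hd\<close> and \<open>last\<close> are meaningful.\<close>

locale compressible = settling +
  fixes H :: "nat set"
  assumes infinite: "infinite H"
    and compress: "occurs H (Suc m) (\<lambda>ys. pattern ys = P) \<Longrightarrow>
      occurs H (Suc m) (\<lambda>ys. pattern ys = P \<and> small (hd ys) (last ys))"
begin

text \<open>For \<open>m = Suc j\<close>, a cut after index \<open>l \<le> j\<close> splits
  \<open>m + 1\<close> entries into \<open>l + 1\<close> and \<open>j - l + 1\<close>. Both parts
  are nonempty, so the last column of the glued pattern reveals \<open>l\<close>, and gluing is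
  injective on the disjoint sum.\<close>

lemma catalan_le_card_packed: "catalan m \<le> card (packed H (Suc m))"
proof (induction m rule: less_induct)
  case (less m)
  show ?case
  proof (cases m)
    case 0
    have "{} \<in> packed H (Suc 0)"
      unfolding packed_def occurs_def mem_Collect_eq
    proof
      fix a
      obtain h where "h \<in> H" "a \<le> h"
        using infinite by (meson infinite_nat_iff_unbounded_le)
      then show "\<exists>ys. length ys = Suc 0 \<and> sorted_wrt (<) ys \<and> set ys \<subseteq> H \<inter> {a..} \<and> pattern ys = {}"
        by (intro exI[of _ "[h]"]) (auto simp: pattern_def)
    qed
    then have "0 < card (packed H (Suc 0))" using finite_packed by (metis card_gt_0_iff empty_iff)
    then show ?thesis using 0 by simp
  next
    case (Suc j)
    let ?I = "SIGMA l:{..j}. packed H (Suc l) \<times> packed H (Suc (j - l))"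
    let ?g = "\<lambda>(l, P, Q). glue l (Suc m) P Q"
    have "catalan m = (\<Sum>l\<le>j. catalan l * catalan (j - l))" using Suc by simp
    also have "\<dots> \<le> (\<Sum>l\<le>j. card (packed H (Suc l)) * card (packed H (Suc (j - l))))"
      using less.IH Suc by (intro sum_mono mult_mono) auto
    also have "\<dots> = card ?I" by (simp add: card_cartesian_product finite_packed)
    also have "\<dots> \<le> card (packed H (Suc m))"
    proof (rule card_inj_on_le)
      show "finite (packed H (Suc m))" by (rule finite_packed)
      show "?g ` ?I \<subseteq> packed H (Suc m)"
      proof clarify
        fix l P Q assume l: "l \<le> j" and P: "P \<in> packed H (Suc l)" and Q: "Q \<in> packed H (Suc (j - l))"
        \<comment> \<open>Only the first part is compressed; the second merely has to occur.\<close>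
        have "occurs H (Suc l + Suc (j - l)) (\<lambda>zs. \<exists>ys. length ys = Suc (j - l) \<and> pattern ys = Q \<and>
            pattern zs = glue l (Suc l + Suc (j - l)) P (pattern ys) \<and>
            small_steps zs = {..<l} \<union> {i. l < i \<and> i - Suc l \<in> small_steps ys})"
          using P Q unfolding packed_def mem_Collect_eq by (intro occurs_append compress)
        moreover have "Suc l + Suc (j - l) = Suc m" using l Suc by simp
        ultimately show "glue l (Suc m) P Q \<in> packed H (Suc m)"
          unfolding packed_def mem_Collect_eq by (auto elim: occurs_mono)
      qed
      show "inj_on ?g ?I"
      proof (rule inj_onI)
        fix u v assume uv: "u \<in> ?I" "v \<in> ?I" "?g u = ?g v"
        obtain l P Q where u: "u = (l, P, Q)" by (rule prod_cases3)
        obtain l' P' Q' where v: "v = (l', P', Q')" by (rule prod_cases3)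
        have eq: "glue l (Suc m) P Q = glue l' (Suc m) P' Q'" using uv(3) u v by simp
        have P: "P \<subseteq> pairs (Suc l)" "P' \<subseteq> pairs (Suc l')"
          using uv(1,2) u v by (auto dest: packed_subset)
        have "Suc l < Suc m" "Suc l' < Suc m" using uv(1,2) u v Suc by auto
        then have "l = l'" using glue_index[OF P(1)] glue_index[OF P(2)] eq by metis
        then show "u = v" using glue_inject[of l "Suc m" P Q P' Q'] eq P u v by simp
      qed
    qed
    finally show ?thesis .
  qed
qed

text \<open>Now only \<open>m\<close> entries are distributed, so the second part may be empty and
  the pattern need not show the cut. The least index outside the set of small steps does. The first
  part contributes only a pattern, because all its steps are small.\<close>

lemma catalan_le_card_colors: "catalan m \<le> card (colors H m)"
proof (induction m rule: less_induct)
  case (less m)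
  show ?case
  proof (cases m)
    case 0
    have "({}, {}) \<in> colors H 0"
      by (auto simp: colors_def occurs_def color_def pattern_def small_steps_def)
    then have "0 < card (colors H 0)" using finite_colors by (metis card_gt_0_iff empty_iff)
    then show ?thesis using 0 by simp
  next
    case (Suc j)
    let ?I = "SIGMA l:{..j}. packed H (Suc l) \<times> colors H (j - l)"
    let ?s = "\<lambda>l G. {..<l} \<union> {i. l < i \<and> i - Suc l \<in> G}"
    let ?g = "\<lambda>(l, P, Q, G). (glue l m P Q, ?s l G)"
    have "catalan m = (\<Sum>l\<le>j. catalan l * catalan (j - l))" using Suc by simp
    also have "\<dots> \<le> (\<Sum>l\<le>j. card (packed H (Suc l)) * card (colors H (j - l)))"
      using less.IH Suc catalan_le_card_packed by (intro sum_mono mult_mono) auto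
    also have "\<dots> = card ?I" by (simp add: card_cartesian_product finite_packed finite_colors)
    also have "\<dots> \<le> card (colors H m)"
    proof (rule card_inj_on_le)
      show "finite (colors H m)" by (rule finite_colors)
      show "?g ` ?I \<subseteq> colors H m"
      proof clarify
        fix l P Q G assume l: "l \<le> j" and P: "P \<in> packed H (Suc l)" and Q: "(Q, G) \<in> colors H (j - l)"
        have "occurs H (Suc l + (j - l)) (\<lambda>zs. \<exists>ys. length ys = j - l \<and> color ys = (Q, G) \<and>
            pattern zs = glue l (Suc l + (j - l)) P (pattern ys) \<and>
            small_steps zs = ?s l (small_steps ys))"
          using P Q unfolding packed_def colors_def mem_Collect_eq by (intro occurs_append compress)
        moreover have "Suc l + (j - l) = m" using l Suc by simp
        ultimately show "(glue l m P Q, ?s l G) \<in> colors H m"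
          unfolding colors_def mem_Collect_eq by (auto simp: color_def elim!: occurs_mono)
      qed
      show "inj_on ?g ?I"
      proof (rule inj_onI)
        fix u v assume uv: "u \<in> ?I" "v \<in> ?I" "?g u = ?g v"
        obtain l P Q G where u: "u = (l, P, Q, G)" by (rule prod_cases4)
        obtain l' P' Q' G' where v: "v = (l', P', Q', G')" by (rule prod_cases4)
        have eq: "glue l m P Q = glue l' m P' Q'" "?s l G = ?s l' G'" using uv(3) u v by simp_all
        have P: "P \<subseteq> pairs (Suc l)" "P' \<subseteq> pairs (Suc l')"
          using uv(1,2) u v by (auto dest: packed_subset)
        have s: "(LEAST i. i \<notin> ?s l G) = l" for l G
          by (rule Least_equality) (auto simp: not_less[symmetric])
        have "l = l'" using s[of l G] s[of l' G'] eq(2) by simp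
        moreover have G: "{i. i + Suc l \<in> ?s l G} = G" for l G by auto
        have "G = G'" using G[of l G, unfolded eq(2)] G[of l' G'] \<open>l = l'\<close> by simp
        ultimately show "u = v" using glue_inject[of l m P Q P' Q'] eq(1) P u v by simp
      qed
    qed
    finally show ?thesis .
  qed
qed

end

section \<open>Coding arithmetical sets into colorings\<close>

definition witness_jump :: "nat \<Rightarrow> (nat list \<Rightarrow> bool) \<Rightarrow> nat \<Rightarrow> nat \<Rightarrow> nat \<Rightarrow> bool" where
  "witness_jump k P a b c \<longleftrightarrow> (\<exists>zs. length zs = k \<and> set zs \<subseteq> {..a} \<and>
     (\<exists>x\<le>c. P (x # zs)) \<and> \<not> (\<exists>x\<le>b. P (x # zs)))"

text \<open>Only finitely many tuples are bounded by \<open>a\<close>, so some stage bounds all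
  their least witnesses.\<close>

lemma settling_witness_jump: "settling (witness_jump k P)"
proof
  fix a b c a' b' c'
  assume "witness_jump k P a b c" and le: "a \<le> a'" "b' \<le> b" "c \<le> c'"
  then obtain zs where "length zs = k" "set zs \<subseteq> {..a}" "\<exists>x\<le>c. P (x # zs)" "\<not> (\<exists>x\<le>b. P (x # zs))"
    unfolding witness_jump_def by blast
  moreover from this(2) have "set zs \<subseteq> {..a'}" using le(1) by auto
  ultimately show "witness_jump k P a' b' c'"
    unfolding witness_jump_def using le(2,3) by (intro exI[of _ zs] conjI) (meson le_trans)+
next
  fix a
  let ?Z = "{zs :: nat list. set zs \<subseteq> {..a} \<and> length zs = k}"
  \<comment> \<open>For a tuple without witness \<open>LEAST\<close> is an unspecified number, which
    does no harm to the bound.\<close>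
  have "finite ((\<lambda>zs. LEAST x. P (x # zs)) ` ?Z)"
    by (intro finite_imageI finite_lists_length_eq) simp
  then obtain b where b: "\<And>zs. zs \<in> ?Z \<Longrightarrow> (LEAST x. P (x # zs)) \<le> b"
    by (auto simp: finite_nat_set_iff_bounded_le)
  have "\<not> witness_jump k P a b c" for c
    unfolding witness_jump_def using b LeastI[of "\<lambda>x. P (x # _)"] by blast
  then show "\<exists>b. \<forall>c. \<not> witness_jump k P a b c" by blast
qed

lemma decidable_in_witness_jump:
  assumes P: "decidable_in X (Suc k) P"
    and F: "computable_in X j F" and G: "computable_in X j G" and H: "computable_in X j H"
  shows "decidable_in X j (\<lambda>xs. witness_jump k P (F xs) (G xs) (H xs))"
proof -
  \<comment> \<open>\<open>ws\<close> lists a candidate \<open>x\<close>, the \<open>k\<close>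
    entries of the tuple under test and three parameters; \<open>P\<close> reads all but the
    parameters.\<close>
  have take: "decidable_in X (Suc (k + 3)) (\<lambda>ws. P (take (Suc k) ws))"
  proof (rule decidable_in_cong)
    show "decidable_in X (Suc (k + 3))
        (\<lambda>ws. P (map (\<lambda>G. G ws) (map (\<lambda>i xs. xs ! i) [0..<Suc k])))"
      by (rule decidable_in_comp[OF P]) (auto intro: computable_in_nth)
    fix ws :: "nat list" assume "length ws = Suc (k + 3)"
    then have "map (\<lambda>i. ws ! i) [0..<Suc k] = take (Suc k) ws"
      by (intro nth_equalityI) (auto simp del: upt_Suc)
    then show "P (map (\<lambda>G. G ws) (map (\<lambda>i xs. xs ! i) [0..<Suc k])) = P (take (Suc k) ws)"
      by (simp add: comp_def del: upt_Suc)
  qed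
  have bex: "decidable_in X (k + 3) (\<lambda>ws. \<exists>x\<le>ws ! (k + i). P (x # take k ws))" if "i < 3" for i
    using decidable_in_bex[OF take, of "\<lambda>ws. ws ! (k + i)"] that by (simp add: computable_in_nth)
  \<comment> \<open>The parameters are \<open>a\<close>, \<open>b\<close>, \<open>c\<close>, so
    behind \<open>k\<close> entries the stages \<open>c\<close> and \<open>b\<close> are found at
    \<open>k + 2\<close> and \<open>k + 1\<close>.\<close>
  have "decidable_in X 3 (\<lambda>zs. \<exists>ys. length ys = k \<and> set ys \<subseteq> {..zs ! 0} \<and>
      ((\<exists>x\<le>(ys @ zs) ! (k + 2). P (x # take k (ys @ zs))) \<and>
       \<not> (\<exists>x\<le>(ys @ zs) ! (k + 1). P (x # take k (ys @ zs)))))"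
    by (intro decidable_in_bex_list decidable_in_conj decidable_in_not bex) simp_all
  then have "decidable_in X 3 (\<lambda>zs. witness_jump k P (zs ! 0) (zs ! 1) (zs ! 2))"
    by (rule decidable_in_cong) (auto simp: witness_jump_def nth_append intro!: iff_exI)
  from decidable_in_comp[OF this, of "[F, G, H]" j] F G H show ?thesis by auto
qed

text \<open>
  If the pattern \<open>Q\<close> never occurs above \<open>a\<close> with its ends a small distance apart, then any
  occurrence of \<open>Q\<close> above \<open>a\<close> and above \<open>zs\<close>, found by search, bounds the least witness for \<open>zs\<close>.
\<close>

lemma compressible_if_undecidable:
  assumes P: "decidable_in H (Suc k) P" and ex: "\<not> decidable_in H k (\<lambda>zs. \<exists>x. P (x # zs))"
    and H: "infinite H"
  shows "compressible (witness_jump k P) H"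
proof -
  interpret settling "witness_jump k P" by (rule settling_witness_jump)
  show ?thesis
  proof
    show "infinite H" by fact
    fix m Q
    define r where "r = Suc m"
    assume occ: "occurs H (Suc m) (\<lambda>ys. pattern ys = Q)"
    show "occurs H (Suc m) (\<lambda>ys. pattern ys = Q \<and> small (hd ys) (last ys))"
    proof (rule ccontr)
      assume "\<not> ?thesis"
      then obtain a where a: "\<And>ys. length ys = r \<Longrightarrow> sorted_wrt (<) ys \<Longrightarrow> set ys \<subseteq> H \<inter> {a..} \<Longrightarrow>
          pattern ys = Q \<Longrightarrow> \<not> small (hd ys) (last ys)"
        unfolding occurs_def r_def by blast
      have Q: "Q \<subseteq> pairs r" using occ by (intro packed_subset) (simp add: packed_def r_def)
      \<comment> \<open>\<open>ws\<close> stands for \<open>ys @ t # zs\<close> with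
        \<open>r\<close> entries in \<open>ys\<close> and the search bound \<open>t\<close> at index
        \<open>r\<close>, so \<open>zs\<close> starts at \<open>r + 1\<close>. The constants
        \<open>a\<close> and \<open>Q\<close> enter the code nonuniformly.\<close>
      define W where "W ws \<longleftrightarrow> (\<forall>i\<in>{..<r}. ws ! i \<in> H \<and> a \<le> ws ! i \<and>
          (\<forall>j\<in>{..<k}. ws ! (r + Suc j) \<le> ws ! i) \<and> (\<forall>j\<in>{i<..<r}. ws ! i < ws ! j)) \<and>
          (\<forall>p\<in>pairs r. witness_jump k P (ws ! fst p) (ws ! Suc (fst p)) (ws ! snd p) \<longleftrightarrow> p \<in> Q)"
        for ws
      have "decidable_in H (r + Suc k) W"
        unfolding W_def
        by (intro decidable_in_conj decidable_in_ball_finite decidable_in_oracle decidable_in_le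
            decidable_in_less decidable_in_iff_const decidable_in_witness_jump P computable_in_nth
            computable_in_const finite_pairs) (auto simp: pairs_def)
      \<comment> \<open>Bounding the entries of \<open>ys\<close> by \<open>t\<close> turns the
        search for an occurrence into one over the single number \<open>t\<close>.\<close>
      from decidable_in_bex_list[OF this, of 0]
      have D: "decidable_in H (Suc k)
          (\<lambda>ts. \<exists>ys. length ys = r \<and> set ys \<subseteq> {..ts ! 0} \<and> W (ys @ ts))" by simp
      have W: "W (ys @ t # zs) \<longleftrightarrow> set ys \<subseteq> H \<inter> {a..} \<and> (\<forall>z\<in>set zs. \<forall>y\<in>set ys. z \<le> y) \<and>
          sorted_wrt (<) ys \<and> pattern ys = Q"
        if "length ys = r" "length zs = k" for ys zs t
      proof -
        have "pattern ys = Q \<longleftrightarrow>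
            (\<forall>p\<in>pairs r. witness_jump k P (ys ! fst p) (ys ! Suc (fst p)) (ys ! snd p) \<longleftrightarrow> p \<in> Q)"
          using Q that(1) by (auto simp: pattern_def pairs_def)
        also have "\<dots> \<longleftrightarrow> (\<forall>p\<in>pairs r. witness_jump k P ((ys @ t # zs) ! fst p)
            ((ys @ t # zs) ! Suc (fst p)) ((ys @ t # zs) ! snd p) \<longleftrightarrow> p \<in> Q)"
          using that(1) by (intro ball_cong) (auto simp: pairs_def nth_append)
        finally have pattern: "pattern ys = Q \<longleftrightarrow> \<dots>" .
        show ?thesis
          unfolding W_def pattern[symmetric] using that
          by (auto simp: nth_append all_set_conv_all_nth sorted_wrt_iff_nth_less set_conv_nth
              subset_iff)
      qed
      \<comment> \<open>Since \<open>Q\<close> occurs arbitrarily far out, the search ends for each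
        \<open>zs\<close>.\<close>
      have "\<exists>t. \<exists>ys. length ys = r \<and> set ys \<subseteq> {..(t # zs) ! 0} \<and> W (ys @ t # zs)"
        if zs: "length zs = k" for zs
      proof -
        obtain b where b: "set zs \<subseteq> {..b}" by (meson List.finite_set finite_nat_iff_bounded_le)
        from occ obtain ys where ys: "length ys = r" "sorted_wrt (<) ys"
            "set ys \<subseteq> H \<inter> {max a b..}" "pattern ys = Q"
          unfolding occurs_def r_def by blast
        obtain t where "set ys \<subseteq> {..t}" by (meson List.finite_set finite_nat_iff_bounded_le)
        moreover have "W (ys @ t # zs)"
          unfolding W[OF ys(1) zs] using ys b by fastforce
        ultimately show ?thesis using ys(1) by auto
      qed
      from decidable_in_bex[OF P computable_in_Least[OF D this]]
      have "decidable_in H k (\<lambda>zs. \<exists>x. P (x # zs))"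
      proof (rule decidable_in_cong)
        fix zs :: "nat list" assume zs: "length zs = k"
        let ?D = "\<lambda>t. \<exists>ys. length ys = r \<and> set ys \<subseteq> {..(t # zs) ! 0} \<and> W (ys @ t # zs)"
        let ?t = "LEAST t. ?D t"
        have "?D ?t" using \<open>\<And>zs. length zs = k \<Longrightarrow> _ zs\<close>[OF zs] by (rule LeastI_ex)
        then obtain ys where ys: "length ys = r" "set ys \<subseteq> {..?t}" "W (ys @ ?t # zs)" by auto
        have ne: "ys \<noteq> []" using ys(1) by (auto simp: r_def)
        have far: "\<not> small (hd ys) (last ys)" and hd: "set zs \<subseteq> {..hd ys}"
          using ys(3) a[OF ys(1)] ne unfolding W[OF ys(1) zs] by auto
        \<comment> \<open>A first witness beyond \<open>last ys\<close> would be a jump that makes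
          the distance from \<open>hd ys\<close> to \<open>last ys\<close> small.\<close>
        have "\<exists>x\<le>last ys. P (x # zs)" if "P (x # zs)" for x
          using far hd zs that unfolding small_def witness_jump_def by blast
        moreover have "last ys \<le> ?t" using last_in_set[OF ne] ys(2) by (meson atMost_iff subsetD)
        ultimately show "(\<exists>x\<le>?t. P (x # zs)) \<longleftrightarrow> (\<exists>x. P (x # zs))"
          by (meson le_trans)
      qed
      with ex show False ..
    qed
  qed
qed

section \<open>Relations that can be forced by a coloring\<close>

definition forced_by_coloring :: "nat \<Rightarrow> nat \<Rightarrow> (nat list \<Rightarrow> bool) \<Rightarrow> bool" where
  "forced_by_coloring n k P \<longleftrightarrow> (\<exists>f :: nat set \<Rightarrow> nat. finite (f ` nsets UNIV n) \<and>
     (\<forall>H. infinite H \<and> card (f ` nsets H n) < catalan n \<longrightarrow> decidable_in H k P))"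

text \<open>Colors are paired; the projections map the colors of \<open>h\<close> on
  \<open>H\<close> onto those of \<open>f\<close> and of \<open>g\<close>, so few colors for
  \<open>h\<close> mean few for both.\<close>

lemma joint_coloring:
  fixes f g :: "nat set \<Rightarrow> nat"
  assumes f: "finite (f ` nsets UNIV n)" and g: "finite (g ` nsets UNIV n)"
  obtains h :: "nat set \<Rightarrow> nat" where "finite (h ` nsets UNIV n)"
    and "\<And>H. card (f ` nsets H n) \<le> card (h ` nsets H n)"
    and "\<And>H. card (g ` nsets H n) \<le> card (h ` nsets H n)"
proof
  let ?h = "\<lambda>s. prod_encode (f s, g s)"
  have "?h ` nsets UNIV n \<subseteq> prod_encode ` (f ` nsets UNIV n \<times> g ` nsets UNIV n)" by auto
  then show fin: "finite (?h ` nsets UNIV n)"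
    by (rule finite_subset) (use f g in blast)
  fix H :: "nat set"
  have fin: "finite (?h ` nsets H n)"
    by (rule finite_subset[OF image_mono fin]) (simp add: nsets_mono)
  have "f ` nsets H n = (fst \<circ> prod_decode) ` ?h ` nsets H n"
    and "g ` nsets H n = (snd \<circ> prod_decode) ` ?h ` nsets H n"
    by (simp_all add: image_image)
  then show "card (f ` nsets H n) \<le> card (?h ` nsets H n)"
    and "card (g ` nsets H n) \<le> card (?h ` nsets H n)"
    using card_image_le[OF fin] by metis+
qed

lemma forced_by_coloring_decidable:
  "(\<And>H. decidable_in H k P) \<Longrightarrow> forced_by_coloring n k P"
  unfolding forced_by_coloring_def by (rule exI[of _ "\<lambda>_. 0"]) (simp add: image_constant_conv)

lemma forced_by_coloring_not:
  "forced_by_coloring n k P \<Longrightarrow> forced_by_coloring n k (\<lambda>xs. \<not> P xs)"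
  unfolding forced_by_coloring_def using decidable_in_not by blast

lemma forced_by_coloring_conj:
  assumes "forced_by_coloring n k P" and "forced_by_coloring n k Q"
  shows "forced_by_coloring n k (\<lambda>xs. P xs \<and> Q xs)"
proof -
  obtain f g :: "nat set \<Rightarrow> nat" where f: "finite (f ` nsets UNIV n)"
      "\<And>H. infinite H \<Longrightarrow> card (f ` nsets H n) < catalan n \<Longrightarrow> decidable_in H k P"
    and g: "finite (g ` nsets UNIV n)"
      "\<And>H. infinite H \<Longrightarrow> card (g ` nsets H n) < catalan n \<Longrightarrow> decidable_in H k Q"
    using assms unfolding forced_by_coloring_def by metis
  obtain h :: "nat set \<Rightarrow> nat" where
    h: "finite (h ` nsets UNIV n)" "\<And>H. card (f ` nsets H n) \<le> card (h ` nsets H n)"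
      "\<And>H. card (g ` nsets H n) \<le> card (h ` nsets H n)"
    using joint_coloring[OF f(1) g(1)] by blast
  show ?thesis
    unfolding forced_by_coloring_def using f(2) g(2) h decidable_in_conj
    by (intro exI[of _ h]) (meson le_less_trans)
qed

text \<open>\<open>h\<close> joins a coloring that forces \<open>P\<close> with the coloring by
  \<open>color\<close>. An \<open>H\<close> with fewer than \<open>catalan n\<close> colors decides
  \<open>P\<close>, so an undecided projection would make \<open>H\<close> compressible and yield at
  least \<open>catalan n\<close> colors.\<close>

lemma forced_by_coloring_ex:
  assumes "forced_by_coloring n (Suc k) P"
  shows "forced_by_coloring n k (\<lambda>xs. \<exists>x. P (x # xs))"
proof -
  interpret settling "witness_jump k P" by (rule settling_witness_jump)
  obtain f :: "nat set \<Rightarrow> nat" where f: "finite (f ` nsets UNIV n)"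
      "\<And>H. infinite H \<Longrightarrow> card (f ` nsets H n) < catalan n \<Longrightarrow> decidable_in H (Suc k) P"
    using assms unfolding forced_by_coloring_def by metis
  let ?C = "color ` {ys. length ys = n}"
  obtain e :: "_ \<Rightarrow> nat" where e: "inj_on e ?C"
    using finite_imp_inj_to_nat_seg[OF finite_color] by metis
  let ?g = "\<lambda>s. e (color (sorted_list_of_set s))"
  have "?g ` nsets UNIV n \<subseteq> e ` ?C" by (auto simp: nsets_def)
  then have g: "finite (?g ` nsets UNIV n)" by (rule finite_subset) (simp add: finite_color)
  obtain h :: "nat set \<Rightarrow> nat" where
    h: "finite (h ` nsets UNIV n)" "\<And>H. card (f ` nsets H n) \<le> card (h ` nsets H n)"
      "\<And>H. card (?g ` nsets H n) \<le> card (h ` nsets H n)"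
    using joint_coloring[OF f(1) g] by blast
  have "decidable_in H k (\<lambda>xs. \<exists>x. P (x # xs))"
    if H: "infinite H" "card (h ` nsets H n) < catalan n" for H
  proof (rule ccontr)
    assume "\<not> ?thesis"
    moreover have "decidable_in H (Suc k) P" using f(2) H h(2) le_less_trans by blast
    ultimately interpret compressible "witness_jump k P" H
      using H(1) by (intro compressible_if_undecidable)
    have "colors H n \<subseteq> (\<lambda>s. color (sorted_list_of_set s)) ` nsets H n"
    proof
      fix C assume "C \<in> colors H n"
      then obtain ys where ys: "sorted_wrt (<) ys" "length ys = n" "set ys \<subseteq> H" "C = color ys"
        using colors_subset by blast
      then have "sorted_list_of_set (set ys) = ys" by (simp add: sorted_list_of_set.idem_if_sorted_distinct strict_sorted_iff)
      moreover have "set ys \<in> nsets H n"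
        using ys by (simp add: nsets_def strict_sorted_iff distinct_card)
      ultimately show "C \<in> (\<lambda>s. color (sorted_list_of_set s)) ` nsets H n" using ys(4) by force
    qed
    then have "e ` colors H n \<subseteq> ?g ` nsets H n" by auto
    moreover have "finite (?g ` nsets H n)"
      by (rule finite_subset[OF image_mono g]) (simp add: nsets_mono)
    ultimately have "card (e ` colors H n) \<le> card (?g ` nsets H n)" by (rule card_mono[rotated])
    moreover have "inj_on e (colors H n)"
      by (rule inj_on_subset[OF e]) (use colors_subset in blast)
    ultimately have "card (colors H n) \<le> card (?g ` nsets H n)" by (simp add: card_image)
    then show False using catalan_le_card_colors[of n] h(3)[of H] H(2) by linarith
  qed
  then show ?thesis unfolding forced_by_coloring_def using h(1) by blast
qed

section \<open>Induction on formulas and the conclusion\<close>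

definition env :: "nat list \<Rightarrow> nat \<Rightarrow> nat" where
  "env xs i = (if i < length xs then xs ! i else 0)"

text \<open>Matches the binding of de Bruijn index 0 in \<open>sat\<close> with the quantified first
  entry in \<open>forced_by_coloring_ex\<close>.\<close>

lemma env_Cons: "env (x # xs) = case_nat x (env xs)"
  by (auto simp: env_def fun_eq_iff split: nat.split)

lemma computable_in_aval: "computable_in X k (\<lambda>xs. aval (env xs) t)"
proof (induction t)
  case (AVar i)
  have "computable_in X k (\<lambda>xs. if i < k then xs ! i else 0)"
    by (cases "i < k") (simp_all add: computable_in_nth computable_in_const)
  then show ?case by (rule computable_in_cong) (simp add: env_def)
qed (simp_all add: computable_in_const computable_in_Suc computable_in_add computable_in_mult)

lemma forced_by_coloring_sat: "forced_by_coloring n k (\<lambda>xs. sat (env xs) p)"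
\<comment> \<open>\<open>n\<close> stays fixed, but \<open>k\<close> has to vary: the existential
  case needs a coloring for one more free variable.\<close>
proof (induction p arbitrary: k)
  case (FEq s t)
  then show ?case
    by (simp add: forced_by_coloring_decidable decidable_in_eq computable_in_aval)
next
  case (FLess s t)
  then show ?case
    by (simp add: forced_by_coloring_decidable decidable_in_less computable_in_aval)
next
  case (FNeg p)
  then show ?case by (simp add: forced_by_coloring_not)
next
  case (FConj p q)
  then show ?case by (simp add: forced_by_coloring_conj)
next
  case (FEx p)
  from forced_by_coloring_ex[OF FEx.IH] show ?case by (simp add: env_Cons)
qed

theorem theorem3p19:
  fixes A :: "nat set" and n :: nat
  assumes "arithmetical A" and "n \<ge> 1"
  shows "\<exists>(m::nat) (f :: nat set \<Rightarrow> nat). f \<in> nsets UNIV n \<rightarrow> {..<m} \<and>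
           (\<forall>H. infinite H \<and> card (f ` nsets H n) < catalan n \<longrightarrow> computes H A)"
proof -
  obtain p where p: "\<And>e. sat e p \<longleftrightarrow> e 0 \<in> A"
    using assms(1) unfolding arithmetical_def by blast
  obtain f :: "nat set \<Rightarrow> nat" where f: "finite (f ` nsets UNIV n)"
      "\<And>H. infinite H \<Longrightarrow> card (f ` nsets H n) < catalan n \<Longrightarrow>
        decidable_in H 1 (\<lambda>xs. sat (env xs) p)"
    using forced_by_coloring_sat[of n 1 p] unfolding forced_by_coloring_def by metis
  obtain m where "f ` nsets UNIV n \<subseteq> {..<m}"
    using f(1) by (meson finite_nat_iff_bounded)
  moreover have "computes H A" if "decidable_in H 1 (\<lambda>xs. sat (env xs) p)" for H
  proof -
    \<comment> \<open>Variables beyond the first take the default 0 of \<open>env\<close>, which is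
      harmless because \<open>p\<close> defines \<open>A\<close> under every assignment.\<close>
    from that obtain c where c: "\<And>xs. length xs = 1 \<Longrightarrow> evalo H c xs (of_bool (env xs 0 \<in> A))"
      unfolding decidable_in_def computable_in_def p by blast
    have "evalo H c [x] (if x \<in> A then 1 else 0)" for x
      using c[of "[x]"] by (simp add: env_def of_bool_def)
    then show ?thesis unfolding computes_def by blast
  qed
  ultimately show ?thesis using f(2) by (intro exI[of _ m] exI[of _ f]) auto
qed

end
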